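(* Let $X$ be a graph as in the context, $M\in\{A,L,Q\}$, and let $u,v$ be twin vertices of $X$ that are strongly cospectral and periodic (with respect to $M$), with associated eigenvalue $\theta$. Write $\sigma_{uv}^+(M)=\{\lambda_1,\ldots,\lambda_r\}$ with $r\ge2$ and $\lambda_1>\lambda_2$, and let $q$ be as in the context. Then $\frac{\lambda_1-\theta}{\lambda_1-\lambda_2}$ is rational; let $a,b$ be integers with $b>0$, $\gcd(a,b)=1$ and $\frac{\lambda_1-\theta}{\lambda_1-\lambda_2}=\frac ab$. For each integer $k$ put $\tau_k=\frac{2\pi qk}{\lambda_1-\lambda_2}$. (1) Proper fractional revival occurs between $u$ and $v$ (at some time) if and only if $b\nmid q$. (2) Suppose $b\nmid q$ and let $g=\gcd(b,q)$. Then $\{\tau_k: k\in\mathbb Z,\ \tfrac bg\nmid k\}$ is the set of all times at which proper fractional revival occurs between $u$ and $v$. Moreover: (a) if $\nu_2(q)\ge\nu_2(b)$, then neither perfect state transfer nor balanced fractional revival occurs between $u$ and $v$; (b) if $\nu_2(b)\ge\nu_2(q)+1$, then perfect state transfer occurs between $u$ and $v$ with minimum positive time $\frac{b\tau_1}{2g}$, and balanced fractional revival occurs between $u$ and $v$ if and only if $\nu_2(b)\ge\nu_2(q)+2$.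
   Context: $X$ is a connected weighted undirected graph, possibly with loops, no multiple edges, nonzero real edge weights $\omega_{a,b}$ ($0$ if absent). $A$ adjacency matrix, $D$ diagonal degree matrix with $\deg(a)=2\omega_{a,a}+\sum_{b\ne a}\omega_{a,b}$, $L=D-A$, $Q=D+A$. $U(t)=e^{itM}$; $M=\sum_j\lambda_jE_j$ spectral decomposition (distinct eigenvalues, orthogonal projections); $\mathbf e_a$ standard basis vector. Twins: distinct $u,v$ with $N(u)\setminus\{u,v\}=N(v)\setminus\{u,v\}$, $\omega_{u,w}=\omega_{v,w}$ for such $w$, $\omega_{u,u}=\omega_{v,v}$. With $\omega=\omega_{u,u}$, $\eta=\omega_{u,v}$: $\theta=\omega-\eta$ ($M=A$), $\deg(u)-\omega+\eta$ ($M=L$), $\deg(u)+\omega-\eta$ ($M=Q$); $\mathbf e_u-\mathbf e_v$ is a $\theta$-eigenvector. Strongly cospectral: $E_j\mathbf e_u=\pm E_j\mathbf e_v$ for all $j$; $\sigma_{uv}^+(M)=\{\lambda_j:E_j\mathbf e_u=E_j\mathbf e_v\ne0\}$ (for strongly cospectral twins this set has at least two elements, and $\sigma_{uv}^-(M)=\{\lambda_j:E_j\mathbf e_u=-E_j\mathbf e_v\neq 0\}=\{\theta\}$). Vertex $u$ is periodic if $|U(\tau)_{u,u}|=1$ for some $\tau>0$. The ratio condition on a set $S$: $\frac{\lambda_p-\lambda_q}{\lambda_j-\lambda_k}\in\mathbb Q$ for all elements with $\lambda_j\ne\lambda_k$ (it holds for $\sigma_{uv}^+(M)$ here). Definition of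 $q$: for $j=2,\dots,r$ write $\frac{\lambda_1-\lambda_j}{\lambda_1-\lambda_2}=\frac{p_j}{q_j}$, $q_j>0$, $\gcd(p_j,q_j)=1$; $q=\operatorname{lcm}(q_2,\ldots,q_r)$. $(\alpha,\beta)$-fractional revival occurs between $u$ and $v$ at time $\tau$ if $U(\tau)\mathbf e_u=\alpha\mathbf e_u+\beta\mathbf e_v$; proper if $\beta\ne0$; balanced if $|\alpha|=|\beta|$. Perfect state transfer at $\tau$: $|U(\tau)_{u,v}|=1$. $\nu_2(c)$ is the exponent of the largest power of $2$ dividing the nonzero integer $c$. *)

theory Defs
  imports "HOL-Analysis.Analysis" "HOL-Computational_Algebra.Computational_Algebra"
begin

text \<open>
  A weighted graph on the finite vertex type is given by its weight function \<open>w\<close>;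
  \<open>w a b = 0\<close> means that there is no edge between \<open>a\<close> and \<open>b\<close>, and \<open>w a a\<close> is the
  weight of the loop at \<open>a\<close>.
\<close>

definition connected_weighted_graph :: "('n \<Rightarrow> 'n \<Rightarrow> real) \<Rightarrow> bool" where
  "connected_weighted_graph w \<longleftrightarrow>
     (\<forall>a b. w a b = w b a) \<and> (\<forall>a b. (a, b) \<in> {(x, y). w x y \<noteq> 0}\<^sup>*)"

definition neighbours :: "('n \<Rightarrow> 'n \<Rightarrow> real) \<Rightarrow> 'n \<Rightarrow> 'n set" where
  "neighbours w a = {b. w a b \<noteq> 0}"

definition deg :: "('n::finite \<Rightarrow> 'n \<Rightarrow> real) \<Rightarrow> 'n \<Rightarrow> real" where
  "deg w a = 2 * w a a + (\<Sum>b\<in>UNIV - {a}. w a b)"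

definition adjacency_matrix :: "('n::finite \<Rightarrow> 'n \<Rightarrow> real) \<Rightarrow> real^'n^'n" where
  "adjacency_matrix w = (\<chi> a b. w a b)"

definition degree_matrix :: "('n::finite \<Rightarrow> 'n \<Rightarrow> real) \<Rightarrow> real^'n^'n" where
  "degree_matrix w = (\<chi> a b. if a = b then deg w a else 0)"

definition laplacian :: "('n::finite \<Rightarrow> 'n \<Rightarrow> real) \<Rightarrow> real^'n^'n" where
  "laplacian w = degree_matrix w - adjacency_matrix w"

definition signless_laplacian :: "('n::finite \<Rightarrow> 'n \<Rightarrow> real) \<Rightarrow> real^'n^'n" where
  "signless_laplacian w = degree_matrix w + adjacency_matrix w"

definition twins :: "('n \<Rightarrow> 'n \<Rightarrow> real) \<Rightarrow> 'n \<Rightarrow> 'n \<Rightarrow> bool" where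
  "twins w u v \<longleftrightarrow>
     u \<noteq> v \<and>
     neighbours w u - {u, v} = neighbours w v - {u, v} \<and>
     (\<forall>x \<in> neighbours w u - {u, v}. w u x = w v x) \<and>
     w u u = w v v"

definition eigenspace :: "real^'n^'n \<Rightarrow> real \<Rightarrow> (real^'n) set" where
  "eigenspace M l = {x. M *v x = l *\<^sub>R x}"

definition eigenvalues :: "real^'n^'n \<Rightarrow> real set" where
  "eigenvalues M = {l. \<exists>x. x \<noteq> 0 \<and> x \<in> eigenspace M l}"

text \<open>
  The matrix of the orthogonal projection onto the eigenspace: the unique symmetric
  idempotent matrix with that range. For symmetric \<open>M\<close> these are the projections of the
  spectral decomposition.
\<close>

definition eigenprojection :: "real^'n^'n \<Rightarrow> real \<Rightarrow> real^'n^'n" where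
  "eigenprojection M l =
     (THE P. transpose P = P \<and> P ** P = P \<and> range ((*v) P) = eigenspace M l)"

definition strongly_cospectral :: "real^'n^'n \<Rightarrow> 'n \<Rightarrow> 'n \<Rightarrow> bool" where
  "strongly_cospectral M u v \<longleftrightarrow>
     (\<forall>l \<in> eigenvalues M.
        eigenprojection M l *v axis u 1 = eigenprojection M l *v axis v 1 \<or>
        eigenprojection M l *v axis u 1 = - (eigenprojection M l *v axis v 1))"

definition sigma_plus :: "real^'n^'n \<Rightarrow> 'n \<Rightarrow> 'n \<Rightarrow> real set" where
  "sigma_plus M u v =
     {l \<in> eigenvalues M.
        eigenprojection M l *v axis u 1 = eigenprojection M l *v axis v 1 \<and>
        eigenprojection M l *v axis u 1 \<noteq> 0}"

primrec matrix_power :: "'a::semiring_1^'n^'n \<Rightarrow> nat \<Rightarrow> 'a^'n^'n" where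
  "matrix_power A 0 = mat 1"
| "matrix_power A (Suc k) = A ** matrix_power A k"

text \<open>
  The library function \<open>exp\<close> needs a Banach algebra, which the type of square matrices
  is not an instance of.
\<close>

definition matrix_exp :: "complex^'n^'n \<Rightarrow> complex^'n^'n" where
  "matrix_exp A = (\<Sum>k. (1 / fact k) *\<^sub>R matrix_power A k)"

definition transition_matrix :: "real^'n^'n \<Rightarrow> real \<Rightarrow> complex^'n^'n" where
  "transition_matrix M t = matrix_exp (map_matrix (\<lambda>x. \<i> * of_real t * of_real x) M)"

definition periodic_vertex :: "real^'n^'n \<Rightarrow> 'n \<Rightarrow> bool" where
  "periodic_vertex M u \<longleftrightarrow> (\<exists>t>0. cmod (transition_matrix M t $ u $ u) = 1)"

definition fractional_revival ::
    "real^'n^'n \<Rightarrow> 'n \<Rightarrow> 'n \<Rightarrow> complex \<Rightarrow> complex \<Rightarrow> real \<Rightarrow> bool" where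
  "fractional_revival M u v \<alpha> \<beta> t \<longleftrightarrow>
     transition_matrix M t *v axis u 1 = \<alpha> *s axis u 1 + \<beta> *s axis v 1"

definition proper_fractional_revival :: "real^'n^'n \<Rightarrow> 'n \<Rightarrow> 'n \<Rightarrow> real \<Rightarrow> bool" where
  "proper_fractional_revival M u v t \<longleftrightarrow>
     (\<exists>\<alpha> \<beta>. fractional_revival M u v \<alpha> \<beta> t \<and> \<beta> \<noteq> 0)"

definition balanced_fractional_revival :: "real^'n^'n \<Rightarrow> 'n \<Rightarrow> 'n \<Rightarrow> real \<Rightarrow> bool" where
  "balanced_fractional_revival M u v t \<longleftrightarrow>
     (\<exists>\<alpha> \<beta>. fractional_revival M u v \<alpha> \<beta> t \<and> cmod \<alpha> = cmod \<beta>)"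

definition perfect_state_transfer :: "real^'n^'n \<Rightarrow> 'n \<Rightarrow> 'n \<Rightarrow> real \<Rightarrow> bool" where
  "perfect_state_transfer M u v t \<longleftrightarrow> cmod (transition_matrix M t $ u $ v) = 1"

text \<open>The denominator of a rational number in lowest terms (unspecified for irrational \<open>x\<close>).\<close>

definition reduced_denom :: "real \<Rightarrow> nat" where
  "reduced_denom x = (THE d. d > 0 \<and> (\<exists>p::int. coprime p (int d) \<and> x = of_int p / of_nat d))"

definition lcm_denom :: "(nat \<Rightarrow> real) \<Rightarrow> nat \<Rightarrow> nat" where
  "lcm_denom lam r =
     (LCM j\<in>{2..r}. reduced_denom ((lam 1 - lam j) / (lam 1 - lam 2)))"

end

theory Submission
  imports Defs "HOL-Library.Real_Mod"
begin

text \<open>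
  Write \<open>E l\<close> for the orthogonal projection onto the \<open>l\<close>-eigenspace, so that \<open>U(t)\<close> is the sum of
  the \<open>cis (t * l) E l\<close>. Strong cospectrality and the eigenvector \<open>e u - e v\<close> force
  \<open>E l (e v) = E l (e u)\<close> for \<open>l \<noteq> \<theta>\<close> and \<open>E \<theta> (e v) = - E \<theta> (e u)\<close>. Projecting
  \<open>U(t) (e u) = \<alpha> e u + \<beta> e v\<close> to the eigenspaces shows that fractional revival at \<open>t\<close> means
  that all \<open>cis (t * l)\<close> with \<open>l\<close> in \<open>\<sigma>\<^sup>+\<close> equal \<open>\<alpha> + \<beta>\<close> and \<open>cis (t * \<theta>) = \<alpha> - \<beta>\<close>. The first
  condition says that \<open>t\<close> is one of the \<open>\<tau> k\<close>; then \<open>cis (t * (\<lambda>\<^sub>1 - \<theta>)) = cis (2 * pi * q * k * a / b)\<close>,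
  and proper revival, perfect state transfer and balanced revival mean that this number is
  different from \<open>1\<close>, equal to \<open>- 1\<close>, and equal to \<open>\<plusminus> \<i>\<close> respectively. With \<open>d = b div gcd b q\<close> these
  become divisibility conditions of \<open>k\<close>, \<open>2 * k\<close> and \<open>4 * k\<close> by \<open>d\<close>.
\<close>

unbundle no fps_syntax

subsection \<open>The spectral theorem for real symmetric matrices\<close>

text \<open>A maximiser of the Rayleigh quotient on the unit sphere of \<open>S\<close> is an
  eigenvector, because the first variation vanishes in every direction of \<open>S\<close>. Working
  inside an invariant subspace lets this be applied to an orthogonal complement.\<close>

lemma self_adjoint_eigenvector_exists:
  fixes f :: "'a::euclidean_space \<Rightarrow> 'a"
  assumes lin: "linear f" and adj: "\<And>x y. f x \<bullet> y = x \<bullet> f y"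
    and S: "subspace S" "S \<noteq> {0}" and inv: "\<And>x. x \<in> S \<Longrightarrow> f x \<in> S"
  obtains x l where "x \<in> S" "x \<noteq> 0" "f x = l *\<^sub>R x"
proof -
  obtain z where z: "z \<in> S" "z \<noteq> 0"
    using S subspace_0 by blast
  let ?K = "sphere 0 1 \<inter> S"
  have "z /\<^sub>R norm z \<in> ?K"
    using z S by (simp add: subspace_scale)
  then have ne: "?K \<noteq> {}" by blast
  have comp: "compact ?K"
    using S(1) by (simp add: closed_subspace compact_Int_closed)
  have cont: "continuous_on ?K (\<lambda>x. f x \<bullet> x)"
    by (intro continuous_intros linear_continuous_on) (simp add: lin linear_conv_bounded_linear[symmetric])
  obtain x where x: "x \<in> ?K" and max: "\<And>y. y \<in> ?K \<Longrightarrow> f y \<bullet> y \<le> f x \<bullet> x"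
    using continuous_attains_sup[OF comp ne cont] by blast
  define l where "l = f x \<bullet> x"
  have xx: "x \<bullet> x = 1" and xS: "x \<in> S" using x by (auto simp: norm_eq_1)
  have rayleigh: "f y \<bullet> y \<le> l * (y \<bullet> y)" if "y \<in> S" for y
  proof (cases "y = 0")
    case False
    have "y /\<^sub>R norm y \<in> ?K" using False that S by (simp add: subspace_scale)
    then have "f (y /\<^sub>R norm y) \<bullet> (y /\<^sub>R norm y) \<le> l"
      using max l_def by blast
    then show ?thesis using False
      by (simp add: linear_scale[OF lin] dot_square_norm power2_eq_square divide_simps)
  qed (simp add: linear_0[OF lin])
  have perp: "l * (x \<bullet> y) - f x \<bullet> y = 0" if y: "y \<in> S" for y
  proof -
    define m where "m = l * (x \<bullet> y) - f x \<bullet> y"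
    define c where "c = l * (y \<bullet> y) - f y \<bullet> y"
    have c: "c \<ge> 0" using rayleigh[OF y] by (simp add: c_def)
    \<comment> \<open>The Rayleigh bound at \<open>x + t y\<close>; a quadratic in \<open>t\<close>
      that vanishes at 0 and is never negative has no linear term.\<close>
    have q: "0 \<le> 2 * t * m + t\<^sup>2 * c" for t
    proof -
      have "x + t *\<^sub>R y \<in> S" using xS y S(1) by (simp add: subspace_add subspace_scale)
      from rayleigh[OF this] show ?thesis
        using adj[of y x] xx
        by (simp add: linear_add[OF lin] linear_scale[OF lin] inner_add_left inner_add_right
            m_def c_def l_def power2_eq_square algebra_simps inner_commute)
    qed
    have "m = 0"
    proof (rule ccontr)
      assume "m \<noteq> 0"
      \<comment> \<open>At \<open>t = - m * s\<close> the quadratic is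
        \<open>m\<^sup>2 * s * (s * c - 2)\<close>; the summand 1 keeps \<open>s\<close> defined for
        \<open>c = 0\<close> and gives \<open>s * c < 1\<close>.\<close>
      define s where "s = 1 / (c + 1)"
      have s: "s > 0" "s * c < 1" using c by (simp_all add: s_def)
      have "2 * (- m * s) * m + (- m * s)\<^sup>2 * c = (m\<^sup>2 * s) * (s * c - 2)"
        by (simp add: power2_eq_square algebra_simps)
      moreover have "\<dots> < 0" using s \<open>m \<noteq> 0\<close> by (intro mult_pos_neg) auto
      ultimately show False using q[of "- m * s"] by linarith
    qed
    then show ?thesis by (simp add: m_def)
  qed
  \<comment> \<open>The residual lies in \<open>S\<close> by invariance, so it may serve as
    \<open>y\<close> and is orthogonal to itself.\<close>
  have "l *\<^sub>R x - f x \<in> S" using xS S(1) inv by (simp add: subspace_diff subspace_scale)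
  from perp[OF this] have "(l *\<^sub>R x - f x) \<bullet> (l *\<^sub>R x - f x) = 0"
    by (simp add: inner_diff_left inner_diff_right inner_commute algebra_simps)
  then have "f x = l *\<^sub>R x" by simp
  with xS xx show ?thesis by (intro that[of x l]) auto
qed

section \<open>Eigenspaces of a symmetric matrix and their projections\<close>

lemma symmetric_matrix_adjoint:
  fixes M :: "real^'n^'n"
  assumes "transpose M = M"
  shows "(M *v x) \<bullet> y = x \<bullet> (M *v y)"
  by (metis assms dot_lmul_matrix transpose_matrix_vector)

lemma subspace_eigenspace: "subspace (eigenspace M l)"
  by (auto simp: eigenspace_def subspace_def matrix_vector_mult_add_rdistrib
      matrix_vector_right_distrib algebra_simps matrix_vector_mult_scaleR)

lemma eigenspace_orthogonal:
  assumes "transpose M = M" "x \<in> eigenspace M l" "y \<in> eigenspace M m" "l \<noteq> m"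
  shows "x \<bullet> y = 0"
  using symmetric_matrix_adjoint[OF assms(1), of x y] assms(2-4) by (auto simp: eigenspace_def)

text \<open>One eigenvector chosen per eigenvalue gives pairwise orthogonal nonzero vectors, which
  are independent and hence finitely many.\<close>

lemma finite_eigenvalues:
  fixes M :: "real^'n^'n"
  assumes "transpose M = M"
  shows "finite (eigenvalues M)"
proof -
  define x where "x l = (SOME x. x \<noteq> 0 \<and> x \<in> eigenspace M l)" for l
  have x: "x l \<noteq> 0" "x l \<in> eigenspace M l" if "l \<in> eigenvalues M" for l
    using that someI_ex[of "\<lambda>x. x \<noteq> 0 \<and> x \<in> eigenspace M l"] by (auto simp: eigenvalues_def x_def)
  have inj: "inj_on x (eigenvalues M)"
    by (rule inj_onI) (metis x assms eigenspace_orthogonal inner_eq_zero_iff)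
  have "pairwise orthogonal (x ` eigenvalues M)"
    by (auto simp: pairwise_def orthogonal_def) (metis x(2) assms eigenspace_orthogonal)
  then have "independent (x ` eigenvalues M)"
    using x(1) by (intro pairwise_orthogonal_independent) force+
  then show ?thesis
    using independent_imp_finite inj finite_imageD by blast
qed

text \<open>The orthogonal complement of all eigenspaces is invariant under \<open>M\<close>. Were
  it nonzero, it would contain an eigenvector, which would then be orthogonal to itself.\<close>

lemma span_eigenspaces:
  fixes M :: "real^'n^'n"
  assumes sym: "transpose M = M"
  shows "span (\<Union>l\<in>eigenvalues M. eigenspace M l) = UNIV"
proof (rule ccontr)
  let ?E = "\<Union>l\<in>eigenvalues M. eigenspace M l"
  define S where "S = {y. \<forall>x\<in>?E. orthogonal y x}"
  assume "span ?E \<noteq> UNIV"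
  then obtain a where "a \<noteq> 0" "\<forall>x\<in>span ?E. a \<bullet> x = 0"
    using span_not_UNIV_orthogonal by blast
  then have "a \<in> S" unfolding S_def orthogonal_def using span_base by blast
  with \<open>a \<noteq> 0\<close> have "S \<noteq> {0}" by blast
  moreover have "subspace S"
    by (auto simp: S_def subspace_def orthogonal_def inner_add_left)
  moreover have "M *v y \<in> S" if "y \<in> S" for y
    using that by (auto simp: S_def orthogonal_def symmetric_matrix_adjoint[OF sym] eigenspace_def)
  ultimately obtain x l where x: "x \<in> S" "x \<noteq> 0" "M *v x = l *\<^sub>R x"
    using self_adjoint_eigenvector_exists[of "(*v) M" S] symmetric_matrix_adjoint[OF sym]
    by (metis matrix_vector_mul_linear)
  then have "x \<in> ?E" by (auto simp: eigenvalues_def eigenspace_def)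
  with x(1) have "x \<bullet> x = 0" unfolding S_def orthogonal_def by blast
  with x show False by simp
qed

text \<open>The witness is the sum of the outer products of the vectors of an orthonormal basis of
  \<open>S\<close>.\<close>

lemma orthogonal_projection_matrix_exists:
  fixes S :: "(real^'n) set"
  assumes "subspace S"
  shows "\<exists>P::real^'n^'n. transpose P = P \<and> P ** P = P \<and> range ((*v) P) = S"
proof -
  obtain B where B: "B \<subseteq> S" "pairwise orthogonal B" "\<And>x. x \<in> B \<Longrightarrow> norm x = 1"
    "independent B" "span B = S"
    using orthonormal_basis_subspace[OF assms] by metis
  have fin: "finite B" using B independent_imp_finite by blast
  define P :: "real^'n^'n" where "P = (\<chi> i j. \<Sum>b\<in>B. b $ i * b $ j)"
  have P: "P *v x = (\<Sum>b\<in>B. (b \<bullet> x) *\<^sub>R b)" for x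
    by (simp add: vec_eq_iff P_def matrix_vector_mult_def inner_vec_def sum_distrib_right
        sum_distrib_left sum.swap[of _ UNIV B] mult_ac)
  have id: "P *v x = x" if "x \<in> S" for x
  proof -
    have "P *v b = b" if "b \<in> B" for b
    proof -
      have "P *v b = (\<Sum>c\<in>B. if c = b then b else 0)"
        unfolding P using B(2,3) that
        by (intro sum.cong) (auto simp: pairwise_def orthogonal_def dot_square_norm)
      then show ?thesis using fin that by simp
    qed
    then show ?thesis
      using that linear_eq_on_span[of "(*v) P" "\<lambda>x. x" B x] B(5) by (simp add: linear_ident)
  qed
  have "P *v x \<in> S" for x
    unfolding P using B(1) assms by (intro subspace_sum subspace_scale) auto
  then have "range ((*v) P) = S" using id by (auto simp: image_iff) metis
  moreover have "P ** P = P"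
    unfolding matrix_eq using id \<open>\<And>x. P *v x \<in> S\<close>
    by (simp add: matrix_vector_mul_assoc[symmetric])
  moreover have "transpose P = P"
    by (simp add: P_def transpose_def mult.commute)
  ultimately show ?thesis by blast
qed

text \<open>An idempotent fixes its range, so \<open>P ** Q = Q\<close> and
  \<open>Q ** P = P\<close>; transposing the first gives \<open>Q ** P = Q\<close>.\<close>

lemma orthogonal_projection_matrix_unique:
  fixes P Q :: "real^'n^'n"
  assumes "transpose P = P" "P ** P = P" "transpose Q = Q" "Q ** Q = Q"
    and "range ((*v) P) = range ((*v) Q)"
  shows "P = Q"
proof -
  have absorb: "A ** B = B" if idem: "A ** A = A" and sub: "range ((*v) B) \<subseteq> range ((*v) A)" for A B :: "real^'n^'n"
    unfolding matrix_eq
  proof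
    fix x
    obtain y where "B *v x = A *v y" using sub by blast
    then show "(A ** B) *v x = B *v x"
      using idem by (metis matrix_vector_mul_assoc)
  qed
  have "P ** Q = Q" "Q ** P = P" using assms by (auto intro: absorb)
  then show ?thesis by (metis assms(1,3) matrix_transpose_mul)
qed

text \<open>Existence and uniqueness make the definite description denote the projection; everything
  later about it rests on these three properties.\<close>

lemma eigenprojection_props:
  fixes M :: "real^'n^'n"
  shows eigenprojection_symmetric: "transpose (eigenprojection M l) = eigenprojection M l"
    and eigenprojection_idem: "eigenprojection M l ** eigenprojection M l = eigenprojection M l"
    and eigenprojection_range: "range ((*v) (eigenprojection M l)) = eigenspace M l"
proof -
  have "\<exists>!P. transpose P = P \<and> P ** P = P \<and> range ((*v) P) = eigenspace M l"
    using orthogonal_projection_matrix_exists[OF subspace_eigenspace[of M l]]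
      orthogonal_projection_matrix_unique by metis
  from theI'[OF this, folded eigenprojection_def]
  show "transpose (eigenprojection M l) = eigenprojection M l"
    "eigenprojection M l ** eigenprojection M l = eigenprojection M l"
    "range ((*v) (eigenprojection M l)) = eigenspace M l" by auto
qed

lemma eigenprojection_in: "eigenprojection M l *v x \<in> eigenspace M l"
  using eigenprojection_range by blast

lemma eigenprojection_fixes: "x \<in> eigenspace M l \<Longrightarrow> eigenprojection M l *v x = x"
  by (metis eigenprojection_range eigenprojection_idem matrix_vector_mul_assoc imageE)

lemma eigenprojection_kills:
  assumes "transpose M = M" "x \<in> eigenspace M m" "l \<noteq> m"
  shows "eigenprojection M l *v x = 0"
proof -
  let ?y = "eigenprojection M l *v x"
  have "?y \<bullet> ?y = x \<bullet> (eigenprojection M l *v ?y)"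
    by (rule symmetric_matrix_adjoint[OF eigenprojection_symmetric])
  also have "\<dots> = x \<bullet> ?y" by (simp add: eigenprojection_fixes eigenprojection_in)
  also have "\<dots> = 0" using eigenspace_orthogonal[OF assms(1,2) eigenprojection_in] assms(3) by metis
  finally show ?thesis by simp
qed

text \<open>Both sides are linear in \<open>x\<close> and agree on eigenvectors, which span the
  space.\<close>

lemma sum_eigenprojections:
  fixes M :: "real^'n^'n"
  assumes sym: "transpose M = M"
  shows "(\<Sum>l\<in>eigenvalues M. eigenprojection M l *v x) = x"
proof -
  have "linear (\<lambda>x. \<Sum>l\<in>eigenvalues M. eigenprojection M l *v x)"
    by (intro linear_compose_sum ballI) simp
  moreover have "(\<Sum>l\<in>eigenvalues M. eigenprojection M l *v x) = x"
    if x: "x \<in> (\<Union>l\<in>eigenvalues M. eigenspace M l)" for x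
  proof -
    obtain m where m: "m \<in> eigenvalues M" "x \<in> eigenspace M m" using x by blast
    have "(\<Sum>l\<in>eigenvalues M. eigenprojection M l *v x) = (\<Sum>l\<in>eigenvalues M. if l = m then x else 0)"
      using m eigenprojection_fixes eigenprojection_kills[OF sym] by (intro sum.cong) auto
    then show ?thesis using m finite_eigenvalues[OF sym] by simp
  qed
  moreover have "x \<in> span (\<Union>l\<in>eigenvalues M. eigenspace M l)"
    by (simp add: span_eigenspaces[OF sym])
  ultimately show ?thesis
    by (rule linear_eq_on_span[OF _ linear_ident])
qed

text \<open>Powers of the exponent matrix act on each eigenspace as powers of the scalar
  \<open>\<i> * t * l\<close>, so entry by entry the matrix series is a finite combination of scalar
  exponential series.\<close>

lemma transition_matrix_nth:
  fixes M :: "real^'n^'n"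
  assumes sym: "transpose M = M"
  shows "transition_matrix M t $ i $ j =
    (\<Sum>l\<in>eigenvalues M. cis (t * l) * of_real (eigenprojection M l $ i $ j))"
proof -
  let ?S = "eigenvalues M" and ?P = "eigenprojection M"
  define A where "A = map_matrix (\<lambda>x. \<i> * of_real t * of_real x) M"
  \<comment> \<open>Each column of the projection is an eigenvector for \<open>l\<close>.\<close>
  have MP: "(\<Sum>k\<in>UNIV. M $ i $ k * ?P l $ k $ j) = l * ?P l $ i $ j" for i j l
    using eigenprojection_in[of M l "axis j 1"]
    by (auto simp: eigenspace_def matrix_vector_mult_basis vec_eq_iff column_def
        matrix_vector_mult_def[of M])
  have pow: "matrix_power A k $ i $ j =
      (\<Sum>l\<in>?S. (\<i> * of_real (t * l)) ^ k * of_real (?P l $ i $ j))" for k i j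
  proof (induction k arbitrary: i j)
    case 0
    have "(\<Sum>l\<in>?S. ?P l $ i $ j) = (mat 1 :: real^'n^'n) $ i $ j"
      using arg_cong[OF sum_eigenprojections[OF sym, of "axis j 1"], of "\<lambda>x. x $ i"]
      by (simp add: matrix_vector_mult_basis column_def mat_def) (simp add: axis_def)
    from arg_cong[OF this, of complex_of_real] show ?case
      by (simp add: mat_def split: if_splits)
  next
    case (Suc k)
    have "matrix_power A (Suc k) $ i $ j =
        (\<Sum>l\<in>?S. \<Sum>m\<in>UNIV. A $ i $ m * ((\<i> * of_real (t * l)) ^ k * of_real (?P l $ m $ j)))"
      by (simp add: matrix_matrix_mult_def Suc sum_distrib_left sum.swap[of _ UNIV ?S])
    also have "\<dots> = (\<Sum>l\<in>?S. \<i> * of_real t * (\<i> * of_real (t * l)) ^ k *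
        of_real (\<Sum>m\<in>UNIV. M $ i $ m * ?P l $ m $ j))"
      by (simp add: A_def map_matrix_def sum_distrib_left mult_ac)
    also have "\<dots> = (\<Sum>l\<in>?S. (\<i> * of_real (t * l)) ^ Suc k * of_real (?P l $ i $ j))"
      by (simp add: MP mult_ac)
    finally show ?case .
  qed
  have ent: "(\<lambda>k. ((1 / fact k) *\<^sub>R matrix_power A k) $ i $ j) sums
      (\<Sum>l\<in>?S. cis (t * l) * of_real (?P l $ i $ j))" for i j
  proof -
    have "(\<lambda>k. \<Sum>l\<in>?S. ((\<i> * of_real (t * l)) ^ k /\<^sub>R fact k) * of_real (?P l $ i $ j)) sums
        (\<Sum>l\<in>?S. exp (\<i> * of_real (t * l)) * of_real (?P l $ i $ j))"
      by (intro sums_sum sums_mult2 exp_converges)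
    then show ?thesis
      by (simp add: pow scaleR_sum_right cis_conv_exp divide_inverse mult_ac)
  qed
  have "(\<lambda>k. (1 / fact k) *\<^sub>R matrix_power A k) sums
      (\<chi> i j. \<Sum>l\<in>?S. cis (t * l) * of_real (?P l $ i $ j))"
    unfolding sums_def
    by (intro vec_tendstoI) (use ent in \<open>simp add: sums_def\<close>)
  then have "matrix_exp A = (\<chi> i j. \<Sum>l\<in>?S. cis (t * l) * of_real (?P l $ i $ j))"
    unfolding matrix_exp_def by (simp add: sums_iff)
  then show ?thesis by (simp add: transition_matrix_def A_def)
qed

section \<open>Entries of the spectral projections\<close>

lemma matrix_vector_mult_axis_nth [simp]:
  fixes A :: "'a::semiring_1^'n^'m"
  shows "(A *v axis j 1) $ i = A $ i $ j"
  by (simp add: matrix_vector_mult_def axis_def if_distrib cong: if_cong)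

lemma eigenprojection_nth_commute:
  fixes M :: "real^'n^'n"
  shows "eigenprojection M l $ i $ j = eigenprojection M l $ j $ i"
  using arg_cong[OF eigenprojection_symmetric[of M l], of "\<lambda>A. A $ j $ i"]
  by (simp add: transpose_def)

lemma eigenprojection_mult_nth:
  fixes M :: "real^'n^'n"
  assumes "transpose M = M"
  shows "(\<Sum>k\<in>UNIV. eigenprojection M m $ i $ k * eigenprojection M l $ k $ j) =
    (if l = m then eigenprojection M m $ i $ j else 0)"
proof -
  have "(\<Sum>k\<in>UNIV. eigenprojection M m $ i $ k * eigenprojection M l $ k $ j) =
      (eigenprojection M m *v (eigenprojection M l *v axis j 1)) $ i"
    by (simp add: matrix_vector_mult_def[of "eigenprojection M m"])
  then show ?thesis
    using eigenprojection_kills[OF assms eigenprojection_in[of M l "axis j 1"], of m]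
    by (auto simp: eigenprojection_fixes[OF eigenprojection_in])
qed

lemma sum_eigenprojections_nth:
  fixes M :: "real^'n^'n"
  assumes "transpose M = M"
  shows "(\<Sum>l\<in>eigenvalues M. eigenprojection M l $ i $ j) = (if i = j then 1 else 0)"
  using arg_cong[OF sum_eigenprojections[OF assms, of "axis j 1"], of "\<lambda>x. x $ i"]
  by simp (simp add: axis_def)

text \<open>By symmetry and idempotence the diagonal entry is the sum of squares of its
  column.\<close>

lemma eigenprojection_diag_pos:
  fixes M :: "real^'n^'n"
  assumes "transpose M = M" and "eigenprojection M l *v axis u 1 \<noteq> 0"
  shows "eigenprojection M l $ u $ u > 0"
proof -
  obtain i where "eigenprojection M l $ i $ u \<noteq> 0"
    using assms(2) by (auto simp: vec_eq_iff)
  then have "(\<Sum>k\<in>UNIV. (eigenprojection M l $ k $ u)\<^sup>2) > 0"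
    by (intro sum_pos2[of _ i]) auto
  also have "(\<Sum>k\<in>UNIV. (eigenprojection M l $ k $ u)\<^sup>2) = eigenprojection M l $ u $ u"
    unfolding power2_eq_square
    by (subst (1) eigenprojection_nth_commute) (simp add: eigenprojection_mult_nth[OF assms(1)])
  finally show ?thesis .
qed

subsection \<open>Revival and transfer as phase conditions\<close>

text \<open>
  The weighted variance of the \<open>z i\<close> is \<open>1 - cmod s ^ 2\<close>, so it vanishes when the mean \<open>s\<close> is
  unimodular.
\<close>
lemma unimodular_convex_combination:
  fixes z :: "'a \<Rightarrow> complex" and c :: "'a \<Rightarrow> real"
  assumes fin: "finite S" and c: "\<And>i. i \<in> S \<Longrightarrow> c i > 0" "sum c S = 1"
    and z: "\<And>i. i \<in> S \<Longrightarrow> cmod (z i) = 1"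
    and s: "cmod (\<Sum>i\<in>S. z i * of_real (c i)) = 1" and i: "i \<in> S"
  shows "z i = (\<Sum>i\<in>S. z i * of_real (c i))"
proof -
  define s where "s = (\<Sum>i\<in>S. z i * of_real (c i))"
  have dist: "(cmod (z i - s))\<^sup>2 = 2 - 2 * Re (z i * cnj s)" if "i \<in> S" for i
  proof -
    have "(cmod (z i - s))\<^sup>2 = (cmod (z i))\<^sup>2 + (cmod s)\<^sup>2 - 2 * Re (z i * cnj s)"
      unfolding cmod_power2 by (simp add: power2_eq_square algebra_simps)
    then show ?thesis using z[OF that] assms(5) by (simp add: s_def)
  qed
  have "(\<Sum>i\<in>S. c i * Re (z i * cnj s)) = Re (s * cnj s)"
    by (subst (2) s_def) (simp only: sum_distrib_right Re_sum, simp add: algebra_simps)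
  also have "\<dots> = 1"
    using assms(5) by (simp add: complex_norm_square[symmetric] s_def[symmetric])
  finally have mean: "(\<Sum>i\<in>S. c i * Re (z i * cnj s)) = 1" .
  have "(\<Sum>i\<in>S. c i * (cmod (z i - s))\<^sup>2) = (\<Sum>i\<in>S. 2 * c i - 2 * (c i * Re (z i * cnj s)))"
    by (intro sum.cong refl) (simp only: dist right_diff_distrib mult_ac)
  also have "\<dots> = 0"
    by (simp only: sum_subtractf sum_distrib_left[symmetric] mean c(2))
  finally have "(\<Sum>i\<in>S. c i * (cmod (z i - s))\<^sup>2) = 0" .
  then have "c i * (cmod (z i - s))\<^sup>2 = 0"
    using fin c(1) i by (subst (asm) sum_nonneg_eq_0_iff) (auto simp: less_imp_le)
  then show ?thesis using c(1)[OF i] by (simp add: s_def)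
qed

section \<open>Comparing two phases\<close>

lemma cis_eq_cis_iff: "cis x = cis y \<longleftrightarrow> cis (x - y) = 1"
  by (simp add: cis_divide[symmetric] divide_eq_1_iff)

lemma cis_eq_uminus_cis_iff: "cis x = - cis y \<longleftrightarrow> cis (x - y) = - 1"
  by (simp add: cis_divide[symmetric] divide_eq_eq)

text \<open>The squared moduli differ by \<open>4 * cos (x - y)\<close>, and a cosine vanishes
  exactly when the doubled angle has phase -1. The two revival amplitudes are half such a sum and
  difference.\<close>

lemma cmod_add_eq_cmod_diff_cis_iff:
  "cmod (cis x + cis y) = cmod (cis x - cis y) \<longleftrightarrow> cis (2 * (x - y)) = - 1"
proof -
  have "cmod (cis x + cis y) = cmod (cis x - cis y) \<longleftrightarrow>
      (cmod (cis x + cis y))\<^sup>2 = (cmod (cis x - cis y))\<^sup>2"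
    by simp
  also have "\<dots> \<longleftrightarrow> cos (x - y) = 0"
  proof -
    have "(cmod (cis x + cis y))\<^sup>2 - (cmod (cis x - cis y))\<^sup>2 = 4 * cos (x - y)"
      unfolding cmod_power2 by (simp add: power2_sum power2_diff cos_diff)
    then show ?thesis by linarith
  qed
  also have "\<dots> \<longleftrightarrow> cis (2 * (x - y)) = - 1"
    using cos_double_cos[of "x - y"] sin_double[of "x - y"] by (auto simp: complex_eq_iff)
  finally show ?thesis .
qed

text \<open>The graph enters only through a symmetric matrix and the twin eigenvector, so the three
  choices of matrix are treated at once.\<close>

locale strongly_cospectral_twins =
  fixes M :: "real^'n^'n" and \<theta> :: real and u v :: 'n
  assumes sym: "transpose M = M" and neq: "u \<noteq> v"
    and twin_eigenvector: "axis u 1 - axis v 1 \<in> eigenspace M \<theta>"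
    and cospectral: "strongly_cospectral M u v"
begin

lemma twin_nonzero: "(axis u 1 - axis v 1 :: real^'n) \<noteq> 0"
  using neq by (simp add: axis_eq_axis)

lemma twin_eigenvalue: "\<theta> \<in> eigenvalues M"
  using twin_eigenvector twin_nonzero unfolding eigenvalues_def by blast

text \<open>Away from \<theta> the projection kills the twin eigenvector, so the two columns agree.
  At \<theta> the columns differ by that nonzero vector, and strong cospectrality leaves only the
  minus sign.\<close>

lemma eigenprojection_twin:
  "eigenprojection M l $ i $ v = (if l = \<theta> then - 1 else 1) * eigenprojection M l $ i $ u"
proof (cases "l = \<theta>")
  case True
  have "eigenprojection M \<theta> *v axis u 1 - eigenprojection M \<theta> *v axis v 1 = axis u 1 - axis v 1"
    using eigenprojection_fixes[OF twin_eigenvector] by (simp add: matrix_vector_mult_diff_distrib)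
  then have "eigenprojection M \<theta> *v axis u 1 = - (eigenprojection M \<theta> *v axis v 1)"
    using cospectral twin_eigenvalue twin_nonzero unfolding strongly_cospectral_def by force
  from arg_cong[OF this, of "\<lambda>x. x $ i"] True show ?thesis by simp
next
  case False
  then show ?thesis
    using arg_cong[OF eigenprojection_kills[OF sym twin_eigenvector False], of "\<lambda>x. x $ i"]
    by (simp add: matrix_vector_mult_diff_distrib)
qed

lemma sigma_plus_iff:
  "l \<in> sigma_plus M u v \<longleftrightarrow> l \<in> eigenvalues M \<and> l \<noteq> \<theta> \<and> (\<exists>i. eigenprojection M l $ i $ u \<noteq> 0)"
  by (auto simp: sigma_plus_def vec_eq_iff eigenprojection_twin)

lemma theta_notin_sigma_plus: "\<theta> \<notin> sigma_plus M u v"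
  by (simp add: sigma_plus_iff)

lemma eigenprojection_theta_diag: "eigenprojection M \<theta> $ u $ u = 1 / 2"
proof -
  have "eigenprojection M \<theta> $ u $ u - eigenprojection M \<theta> $ u $ v = 1"
    using arg_cong[OF eigenprojection_fixes[OF twin_eigenvector], of "\<lambda>x. x $ u"] neq
    by (simp add: matrix_vector_mult_diff_distrib) (simp add: axis_def)
  then show ?thesis by (simp add: eigenprojection_twin)
qed

text \<open>Applying a projection to the revival equation isolates the phase of one eigenvalue, and
  summing over all eigenvalues recovers the equation. The sign relating the columns at
  \<open>u\<close> and \<open>v\<close> separates \<alpha> + \<beta> from \<alpha> -
  \<beta>.\<close>

lemma fractional_revival_iff:
  "fractional_revival M u v \<alpha> \<beta> t \<longleftrightarrow>
     (\<forall>l\<in>sigma_plus M u v. cis (t * l) = \<alpha> + \<beta>) \<and> cis (t * \<theta>) = \<alpha> - \<beta>"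
proof -
  let ?P = "\<lambda>l i j. complex_of_real (eigenprojection M l $ i $ j)" and ?S = "eigenvalues M"
  have fin: "finite ?S" by (rule finite_eigenvalues[OF sym])
  have "fractional_revival M u v \<alpha> \<beta> t \<longleftrightarrow>
      (\<forall>i. transition_matrix M t $ i $ u = \<alpha> * of_bool (i = u) + \<beta> * of_bool (i = v))"
    by (simp add: fractional_revival_def vec_eq_iff) (simp add: axis_def of_bool_def)
  also have "\<dots> \<longleftrightarrow> (\<forall>l\<in>?S. \<forall>i. cis (t * l) * ?P l i u = \<alpha> * ?P l i u + \<beta> * ?P l i v)"
  proof safe
    fix m j
    assume U: "\<forall>i. transition_matrix M t $ i $ u = \<alpha> * of_bool (i = u) + \<beta> * of_bool (i = v)"
      and m: "m \<in> ?S"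
    have "(\<Sum>i\<in>UNIV. ?P m j i * transition_matrix M t $ i $ u) =
        (\<Sum>l\<in>?S. cis (t * l) * of_real (\<Sum>i\<in>UNIV. eigenprojection M m $ j $ i * eigenprojection M l $ i $ u))"
      by (simp add: transition_matrix_nth[OF sym] sum_distrib_left sum.swap[of _ UNIV ?S] mult_ac)
    also have "\<dots> = (\<Sum>l\<in>?S. if l = m then cis (t * m) * ?P m j u else 0)"
      by (intro sum.cong) (auto simp: eigenprojection_mult_nth[OF sym])
    also have "\<dots> = cis (t * m) * ?P m j u" using fin m by simp
    finally have "cis (t * m) * ?P m j u = (\<Sum>i\<in>UNIV. ?P m j i * transition_matrix M t $ i $ u)" ..
    also have "\<dots> = \<alpha> * ?P m j u + \<beta> * ?P m j v"
      by (simp add: U distrib_left sum.distrib of_bool_def if_distrib[of "\<lambda>x. _ * x"] cong: if_cong)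
    finally show "cis (t * m) * ?P m j u = \<alpha> * ?P m j u + \<beta> * ?P m j v" .
  next
    fix i
    assume H: "\<forall>l\<in>?S. \<forall>i. cis (t * l) * ?P l i u = \<alpha> * ?P l i u + \<beta> * ?P l i v"
    have "transition_matrix M t $ i $ u = (\<Sum>l\<in>?S. \<alpha> * ?P l i u + \<beta> * ?P l i v)"
      unfolding transition_matrix_nth[OF sym] using H by (intro sum.cong) auto
    also have "\<dots> = \<alpha> * of_real (\<Sum>l\<in>?S. eigenprojection M l $ i $ u) +
        \<beta> * of_real (\<Sum>l\<in>?S. eigenprojection M l $ i $ v)"
      by (simp add: sum.distrib sum_distrib_left)
    also have "\<dots> = \<alpha> * of_bool (i = u) + \<beta> * of_bool (i = v)"
      unfolding sum_eigenprojections_nth[OF sym] by simp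
    finally show "transition_matrix M t $ i $ u = \<alpha> * of_bool (i = u) + \<beta> * of_bool (i = v)" .
  qed
  also have "\<dots> \<longleftrightarrow> (\<forall>l\<in>?S. \<forall>i. ?P l i u = 0 \<or> cis (t * l) = (if l = \<theta> then \<alpha> - \<beta> else \<alpha> + \<beta>))"
    by (intro ball_cong all_cong1)
      (auto simp: eigenprojection_twin distrib_right[symmetric] left_diff_distrib[symmetric])
  also have "\<dots> \<longleftrightarrow>
      (\<forall>l\<in>sigma_plus M u v. cis (t * l) = \<alpha> + \<beta>) \<and> cis (t * \<theta>) = \<alpha> - \<beta>"
  proof -
    \<comment> \<open>Only eigenvalues whose projection does not annihilate the vector at
      \<open>u\<close> impose a condition; \<theta> is one of them, its diagonal entry being
      1/2.\<close>
    have "\<exists>i. ?P \<theta> i u \<noteq> 0" by (rule exI[of _ u]) (simp add: eigenprojection_theta_diag)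
    then have supp: "{l \<in> ?S. \<exists>i. ?P l i u \<noteq> 0} = insert \<theta> (sigma_plus M u v)"
      using twin_eigenvalue by (auto simp: sigma_plus_iff)
    have "(\<forall>l\<in>?S. \<forall>i. ?P l i u = 0 \<or> cis (t * l) = (if l = \<theta> then \<alpha> - \<beta> else \<alpha> + \<beta>)) \<longleftrightarrow>
        (\<forall>l\<in>insert \<theta> (sigma_plus M u v). cis (t * l) = (if l = \<theta> then \<alpha> - \<beta> else \<alpha> + \<beta>))"
      unfolding supp[symmetric] by blast
    also have "\<dots> \<longleftrightarrow> (\<forall>l\<in>sigma_plus M u v. cis (t * l) = \<alpha> + \<beta>) \<and> cis (t * \<theta>) = \<alpha> - \<beta>"
      using theta_notin_sigma_plus by auto
    finally show ?thesis .
  qed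
  finally show ?thesis .
qed

text \<open>Comparing with a reference eigenvalue \<open>l0\<close> expresses the common phase
  through differences \<open>l0 - l\<close>, the quantities whose ratios are known to be rational
  later on.\<close>

definition in_phase :: "real \<Rightarrow> real \<Rightarrow> bool" where
  "in_phase l0 t \<longleftrightarrow> (\<forall>l\<in>sigma_plus M u v. cis (t * (l0 - l)) = 1)"

lemma in_phase_iff: "in_phase l0 t \<longleftrightarrow> (\<forall>l\<in>sigma_plus M u v. cis (t * l) = cis (t * l0))"
proof -
  have "cis (t * l) = cis (t * l0) \<longleftrightarrow> cis (t * (l0 - l)) = 1" for l
    unfolding eq_commute[of "cis (t * l)"] by (simp add: cis_eq_cis_iff right_diff_distrib)
  then show ?thesis by (simp add: in_phase_def)
qed

lemma fractional_revival_amplitudes: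
  assumes "l0 \<in> sigma_plus M u v"
  shows "fractional_revival M u v \<alpha> \<beta> t \<longleftrightarrow> in_phase l0 t \<and>
    \<alpha> = (cis (t * l0) + cis (t * \<theta>)) / 2 \<and> \<beta> = (cis (t * l0) - cis (t * \<theta>)) / 2"
proof -
  have "(\<forall>l\<in>sigma_plus M u v. cis (t * l) = \<alpha> + \<beta>) \<longleftrightarrow> in_phase l0 t \<and> cis (t * l0) = \<alpha> + \<beta>"
    using assms unfolding in_phase_iff by metis
  moreover have "cis (t * l0) = \<alpha> + \<beta> \<and> cis (t * \<theta>) = \<alpha> - \<beta> \<longleftrightarrow>
      \<alpha> = (cis (t * l0) + cis (t * \<theta>)) / 2 \<and> \<beta> = (cis (t * l0) - cis (t * \<theta>)) / 2"
    by (auto simp del: eq_divide_eq_numeral1) (auto simp: add_divide_distrib diff_divide_distrib)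
  ultimately show ?thesis unfolding fractional_revival_iff by blast
qed

lemma proper_fractional_revival_iff:
  assumes "l0 \<in> sigma_plus M u v"
  shows "proper_fractional_revival M u v t \<longleftrightarrow> in_phase l0 t \<and> cis (t * (l0 - \<theta>)) \<noteq> 1"
  unfolding proper_fractional_revival_def fractional_revival_amplitudes[OF assms] right_diff_distrib
    cis_eq_cis_iff[symmetric] by (auto simp del: eq_divide_eq_numeral1)

lemma balanced_fractional_revival_iff:
  assumes "l0 \<in> sigma_plus M u v"
  shows "balanced_fractional_revival M u v t \<longleftrightarrow> in_phase l0 t \<and> cis (2 * (t * (l0 - \<theta>))) = - 1"
  unfolding balanced_fractional_revival_def fractional_revival_amplitudes[OF assms]
    right_diff_distrib[of t] cmod_add_eq_cmod_diff_cis_iff[symmetric]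
  by (auto simp: norm_divide simp del: eq_divide_eq_numeral1)

text \<open>
  The signs \<open>\<epsilon>\<close> cover the diagonal entry \<open>U(t)\<^sub>u\<^sub>u\<close> and the entry \<open>U(t)\<^sub>u\<^sub>v\<close>, where
  \<open>(E l)\<^sub>u\<^sub>v = \<plusminus> (E l)\<^sub>u\<^sub>u\<close>, at the same time.
\<close>
lemma transition_matrix_unimodular:
  assumes \<epsilon>: "\<And>l. \<epsilon> l = 1 \<or> \<epsilon> l = (- 1 :: complex)"
    and U: "cmod (\<Sum>l\<in>eigenvalues M. (\<epsilon> l * cis (t * l)) * of_real (eigenprojection M l $ u $ u)) = 1"
    and l0: "l0 \<in> sigma_plus M u v"
  shows "\<epsilon> l0 * cis (t * l0) = \<epsilon> \<theta> * cis (t * \<theta>)"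
    and "l \<in> sigma_plus M u v \<Longrightarrow> \<epsilon> l * cis (t * l) = \<epsilon> l0 * cis (t * l0)"
proof -
  let ?T = "insert \<theta> (sigma_plus M u v)" and ?c = "\<lambda>l. eigenprojection M l $ u $ u"
  have fin: "finite (eigenvalues M)" by (rule finite_eigenvalues[OF sym])
  have sub: "?T \<subseteq> eigenvalues M" using twin_eigenvalue by (auto simp: sigma_plus_iff)
  have zero: "?c l = 0" if "l \<in> eigenvalues M - ?T" for l
    using that by (auto simp: sigma_plus_iff)
  have pos: "?c l > 0" if "l \<in> ?T" for l
    using that eigenprojection_diag_pos[OF sym, of l u]
    by (auto simp: eigenprojection_theta_diag sigma_plus_def)
  have "sum ?c ?T = sum ?c (eigenvalues M)"
    by (rule sum.mono_neutral_left[OF fin sub]) (use zero in auto)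
  then have sum1: "sum ?c ?T = 1" by (simp add: sum_eigenprojections_nth[OF sym])
  define z where "z l = \<epsilon> l * cis (t * l)" for l
  have z: "cmod (z l) = 1" for l using \<epsilon>[of l] by (auto simp: z_def norm_mult)
  have "(\<Sum>l\<in>?T. z l * of_real (?c l)) = (\<Sum>l\<in>eigenvalues M. z l * of_real (?c l))"
    by (rule sum.mono_neutral_left[OF fin sub]) (use zero in auto)
  then have "cmod (\<Sum>l\<in>?T. z l * of_real (?c l)) = 1" using U by (simp add: z_def)
  from unimodular_convex_combination[OF finite_subset[OF sub fin] pos sum1 z this]
  have "z l = z m" if "l \<in> ?T" "m \<in> ?T" for l m using that by metis
  then show "\<epsilon> l0 * cis (t * l0) = \<epsilon> \<theta> * cis (t * \<theta>)"
    and "l \<in> sigma_plus M u v \<Longrightarrow> \<epsilon> l * cis (t * l) = \<epsilon> l0 * cis (t * l0)"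
    using l0 unfolding z_def by blast+
qed

text \<open>With all signs equal to 1, a unimodular diagonal entry forces one phase on the whole
  support, \<theta> included. This is how periodicity is exploited.\<close>

lemma periodic_imp_in_phase:
  assumes "cmod (transition_matrix M t $ u $ u) = 1" and l0: "l0 \<in> sigma_plus M u v"
  shows "in_phase l0 t \<and> cis (t * (l0 - \<theta>)) = 1"
proof -
  have "cmod (\<Sum>l\<in>eigenvalues M. (1 * cis (t * l)) * of_real (eigenprojection M l $ u $ u)) = 1"
    using assms(1) by (simp add: transition_matrix_nth[OF sym])
  from transition_matrix_unimodular[of "\<lambda>_. 1", OF _ this l0] show ?thesis
    unfolding in_phase_iff right_diff_distrib cis_eq_cis_iff[symmetric] by simp
qed

text \<open>Forwards, the sign -1 at \<theta> makes the off-diagonal entry a signed convex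
  combination of phases. Backwards, opposite phases give revival with \<alpha> = 0.\<close>

lemma perfect_state_transfer_iff:
  assumes l0: "l0 \<in> sigma_plus M u v"
  shows "perfect_state_transfer M u v t \<longleftrightarrow> in_phase l0 t \<and> cis (t * (l0 - \<theta>)) = - 1"
proof
  define \<epsilon> :: "real \<Rightarrow> complex" where "\<epsilon> l = (if l = \<theta> then - 1 else 1)" for l
  have U: "transition_matrix M t $ u $ v =
      (\<Sum>l\<in>eigenvalues M. (\<epsilon> l * cis (t * l)) * of_real (eigenprojection M l $ u $ u))"
    unfolding transition_matrix_nth[OF sym]
    by (intro sum.cong) (auto simp: eigenprojection_twin \<epsilon>_def)
  assume "perfect_state_transfer M u v t"
  then have "cmod (\<Sum>l\<in>eigenvalues M. (\<epsilon> l * cis (t * l)) * of_real (eigenprojection M l $ u $ u)) = 1"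
    by (simp add: perfect_state_transfer_def U)
  from transition_matrix_unimodular[OF _ this l0]
  have "\<epsilon> l0 * cis (t * l0) = \<epsilon> \<theta> * cis (t * \<theta>)"
    and "\<And>l. l \<in> sigma_plus M u v \<Longrightarrow> \<epsilon> l * cis (t * l) = \<epsilon> l0 * cis (t * l0)"
    by (auto simp: \<epsilon>_def)
  moreover have "\<epsilon> \<theta> = - 1" "\<And>l. l \<in> sigma_plus M u v \<Longrightarrow> \<epsilon> l = 1"
    using theta_notin_sigma_plus by (auto simp: \<epsilon>_def)
  ultimately show "in_phase l0 t \<and> cis (t * (l0 - \<theta>)) = - 1"
    unfolding in_phase_iff right_diff_distrib cis_eq_uminus_cis_iff[symmetric]
    using l0 by simp
next
  assume ph: "in_phase l0 t \<and> cis (t * (l0 - \<theta>)) = - 1"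
  then have "cis (t * l0) = - cis (t * \<theta>)"
    by (simp add: right_diff_distrib cis_eq_uminus_cis_iff)
  with ph have "fractional_revival M u v 0 (cis (t * l0)) t"
    unfolding fractional_revival_amplitudes[OF l0] by simp
  from arg_cong[OF this[unfolded fractional_revival_def], of "\<lambda>x. x $ v"]
  have "transition_matrix M t $ v $ u = cis (t * l0)"
    by simp
  \<comment> \<open>Revival yields row \<open>v\<close>, column \<open>u\<close>; symmetry of the
    projections gives the transposed entry.\<close>
  then show "perfect_state_transfer M u v t"
    by (simp add: perfect_state_transfer_def transition_matrix_nth[OF sym] eigenprojection_nth_commute[of M _ u v])
qed

end

subsection \<open>Twin vertices\<close>

lemma twins_weight_eq:
  assumes "twins w u v" "x \<noteq> u" "x \<noteq> v"
  shows "w u x = w v x"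
proof (cases "x \<in> neighbours w u - {u, v}")
  case True
  then show ?thesis using assms(1) unfolding twins_def by blast
next
  case False
  then have "x \<notin> neighbours w u" "x \<notin> neighbours w v"
    using assms by (auto simp: twins_def)
  then show ?thesis by (simp add: neighbours_def)
qed

text \<open>After splitting off the edge between the twins, the remaining row sums agree term by
  term.\<close>

lemma twins_deg_eq:
  assumes "\<And>a b. w a b = w b a" and tw: "twins w u v"
  shows "deg w u = deg w v"
proof -
  have uv: "u \<noteq> v" "w u u = w v v" using tw by (auto simp: twins_def)
  have "(\<Sum>b\<in>UNIV - {u}. w u b) = w u v + (\<Sum>b\<in>UNIV - {u} - {v}. w u b)"
    by (rule sum.remove) (use uv in auto)
  moreover have "(\<Sum>b\<in>UNIV - {v}. w v b) = w v u + (\<Sum>b\<in>UNIV - {v} - {u}. w v b)"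
    by (rule sum.remove) (use uv in auto)
  moreover have "(\<Sum>b\<in>UNIV - {u} - {v}. w u b) = (\<Sum>b\<in>UNIV - {v} - {u}. w v b)"
    by (rule sum.cong) (use twins_weight_eq[OF tw] in auto)
  ultimately show ?thesis using uv assms(1)[of u v] by (simp add: deg_def)
qed

text \<open>The columns at \<open>u\<close> and \<open>v\<close> agree in every row outside
  \<open>{u, v}\<close>; in the two remaining rows their difference is plus or minus
  \<theta>.\<close>

lemma twins_eigenvector:
  fixes w :: "'n::finite \<Rightarrow> 'n \<Rightarrow> real"
  assumes graph: "connected_weighted_graph w" and tw: "twins w u v"
    and M: "(M, \<theta>) \<in> {(adjacency_matrix w, w u u - w u v),
                        (laplacian w, deg w u - w u u + w u v),
                        (signless_laplacian w, deg w u + w u u - w u v)}"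
  shows "transpose M = M" and "axis u 1 - axis v 1 \<in> eigenspace M \<theta>"
proof -
  have sym: "w a b = w b a" for a b using graph by (simp add: connected_weighted_graph_def)
  show "transpose M = M"
    using M sym
    by (auto simp: transpose_def vec_eq_iff adjacency_matrix_def laplacian_def
        signless_laplacian_def degree_matrix_def)
  have uv: "u \<noteq> v" "w u u = w v v" using tw by (auto simp: twins_def)
  have out: "w i u = w i v" if "i \<noteq> u" "i \<noteq> v" for i
    using twins_weight_eq[OF tw that] sym by metis
  have entries: "M $ i $ u - M $ i $ v = \<theta> * (of_bool (i = u) - of_bool (i = v))" for i
    using M uv out[of i] sym[of u v] twins_deg_eq[OF sym tw]
    by (cases "i = u"; cases "i = v")
      (auto simp: adjacency_matrix_def laplacian_def signless_laplacian_def degree_matrix_def)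
  have "(M *v (axis u 1 - axis v 1)) $ i = (\<theta> *\<^sub>R (axis u 1 - axis v 1)) $ i" for i
    using entries[of i] by (simp add: matrix_vector_mult_diff_distrib) (simp add: axis_def of_bool_def)
  then show "axis u 1 - axis v 1 \<in> eigenspace M \<theta>"
    by (simp add: eigenspace_def vec_eq_iff)
qed

subsection \<open>Arithmetic of the phases\<close>

lemma reduced_denom_props:
  assumes "x \<in> \<rat>"
  shows "reduced_denom x > 0"
    and "\<exists>p::int. coprime p (int (reduced_denom x)) \<and> x = of_int p / of_nat (reduced_denom x)"
proof -
  let ?P = "\<lambda>d::nat. d > 0 \<and> (\<exists>p::int. coprime p (int d) \<and> x = of_int p / of_nat d)"
  obtain m n :: nat where mn: "n \<noteq> 0" "\<bar>x\<bar> = real m / real n" "coprime m n"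
    using Rats_abs_nat_div_natE[OF assms] by metis
  have "?P n"
  proof (cases "x \<ge> 0")
    case True
    then show ?thesis using mn by (auto intro!: exI[of _ "int m"])
  next
    case False
    then show ?thesis using mn by (auto intro!: exI[of _ "- int m"])
  qed
  \<comment> \<open>Cross-multiplication and coprimality make any two admissible denominators divide
    each other, hence equal.\<close>
  moreover have dvd: "d dvd e" if d: "?P d" and e: "?P e" for d e
  proof -
    obtain p p' :: int where p: "coprime p (int d)" "x = of_int p / of_nat d"
      "x = of_int p' / of_nat e" using d e by blast
    have "real_of_int (p * int e) = real_of_int (p' * int d)"
      using p(2,3) d e by (simp add: field_simps)
    then have "p * int e = p' * int d" by (simp only: of_int_eq_iff)
    then have "int d dvd p * int e" by simp
    then show ?thesis using p(1) by (simp add: coprime_dvd_mult_right_iff coprime_commute)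
  qed
  ultimately have "\<exists>!d. ?P d" by (metis dvd_antisym)
  from theI'[OF this, folded reduced_denom_def]
  show "reduced_denom x > 0"
    "\<exists>p::int. coprime p (int (reduced_denom x)) \<and> x = of_int p / of_nat (reduced_denom x)" by auto
qed

lemma int_fraction_in_Ints_iff:
  fixes m b :: int
  assumes "b \<noteq> 0"
  shows "(of_int m / of_int b :: real) \<in> \<int> \<longleftrightarrow> b dvd m"
proof
  assume "(of_int m / of_int b :: real) \<in> \<int>"
  then obtain n where "of_int m / of_int b = (of_int n :: real)" by (elim Ints_cases)
  then have "real_of_int m = of_int (n * b)" using assms by (simp add: field_simps)
  then have "m = n * b" by (simp only: of_int_eq_iff)
  then show "b dvd m" by simp
next
  assume "b dvd m"
  then show "(of_int m / of_int b :: real) \<in> \<int>" using assms by auto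
qed

lemma int_mult_in_Ints_iff_reduced_denom_dvd:
  fixes n :: int
  assumes "x \<in> \<rat>"
  shows "of_int n * x \<in> \<int> \<longleftrightarrow> int (reduced_denom x) dvd n"
proof -
  obtain p :: int where p: "coprime p (int (reduced_denom x))"
    and x: "x = of_int p / of_nat (reduced_denom x)"
    using reduced_denom_props(2)[OF assms] by blast
  have "of_int n * x = of_int (n * p) / of_int (int (reduced_denom x))"
    by (subst x) simp
  then have "of_int n * x \<in> \<int> \<longleftrightarrow> int (reduced_denom x) dvd n * p"
    using reduced_denom_props(1)[OF assms] by (metis int_fraction_in_Ints_iff less_not_refl of_nat_eq_0_iff)
  then show ?thesis using p by (simp add: coprime_dvd_mult_left_iff coprime_commute)
qed

lemma lcm_denom_pos:
  assumes "\<And>j. j \<in> {2..r} \<Longrightarrow> (lam 1 - lam j) / (lam 1 - lam 2) \<in> \<rat>"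
  shows "lcm_denom lam r > 0"
proof -
  have "lcm_denom lam r \<noteq> 0"
    unfolding lcm_denom_def
    by (subst Lcm_0_iff) (use reduced_denom_props(1)[OF assms] in force)+
  then show ?thesis by simp
qed

text \<open>At \<open>j = 2\<close> the ratio is 1, which already forces \<open>s\<close> to be an
  integer; an integer clears every ratio exactly when all reduced denominators, and so their lcm,
  divide it.\<close>

lemma lcm_denom_dvd_iff:
  assumes rat: "\<And>j. j \<in> {2..r} \<Longrightarrow> (lam 1 - lam j) / (lam 1 - lam 2) \<in> \<rat>"
    and r: "r \<ge> 2" and ne: "lam 1 \<noteq> lam 2"
  shows "(\<forall>j\<in>{2..r}. s * ((lam 1 - lam j) / (lam 1 - lam 2)) \<in> \<int>) \<longleftrightarrow>
    (\<exists>k::int. s = of_int (int (lcm_denom lam r) * k))"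
proof -
  let ?x = "\<lambda>j. (lam 1 - lam j) / (lam 1 - lam 2)"
  have "(\<forall>j\<in>{2..r}. of_int n * ?x j \<in> \<int>) \<longleftrightarrow> int (lcm_denom lam r) dvd n" for n
  proof -
    have "int (lcm_denom lam r) dvd n \<longleftrightarrow> lcm_denom lam r dvd nat \<bar>n\<bar>"
      by (metis int_dvd_int_iff dvd_abs_iff abs_ge_zero int_nat_eq)
    also have "\<dots> \<longleftrightarrow> (\<forall>j\<in>{2..r}. reduced_denom (?x j) dvd nat \<bar>n\<bar>)"
      by (simp only: lcm_denom_def Lcm_dvd_iff ball_simps)
    also have "\<dots> \<longleftrightarrow> (\<forall>j\<in>{2..r}. int (reduced_denom (?x j)) dvd n)"
      by (metis int_dvd_int_iff dvd_abs_iff abs_ge_zero int_nat_eq)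
    also have "\<dots> \<longleftrightarrow> (\<forall>j\<in>{2..r}. of_int n * ?x j \<in> \<int>)"
      by (intro ball_cong refl) (simp only: int_mult_in_Ints_iff_reduced_denom_dvd[OF rat])
    finally show ?thesis by blast
  qed
  moreover have "\<exists>n. s = of_int n" if "\<forall>j\<in>{2..r}. s * ?x j \<in> \<int>"
    using that[rule_format, of 2] r ne by (auto elim: Ints_cases)
  ultimately show ?thesis by (metis dvd_def)
qed

section \<open>Phases that are roots of unity, and divisibility\<close>

lemma cis_2pi_mult_eq_1_iff: "cis (2 * pi * y) = 1 \<longleftrightarrow> y \<in> \<int>"
  by (auto simp: cis_eq_1_iff Ints_def)

lemma cis_2pi_fraction_eq_1_iff:
  fixes m b :: int
  assumes "b > 0"
  shows "cis (2 * pi * (of_int m / of_int b)) = 1 \<longleftrightarrow> b dvd m"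
  using assms int_fraction_in_Ints_iff[of b m] by (simp only: cis_2pi_mult_eq_1_iff)

lemma cis_2pi_fraction_eq_minus_1_iff:
  fixes m b :: int
  assumes "b > 0"
  shows "cis (2 * pi * (of_int m / of_int b)) = - 1 \<longleftrightarrow> b dvd 2 * m \<and> \<not> b dvd m"
proof -
  let ?z = "cis (2 * pi * (of_int m / of_int b))"
  have "?z\<^sup>2 = cis (2 * pi * (of_int (2 * m) / of_int b))"
    by (simp add: power2_eq_square cis_mult)
  then have "?z\<^sup>2 = 1 \<longleftrightarrow> b dvd 2 * m"
    by (simp only: cis_2pi_fraction_eq_1_iff[OF assms])
  moreover have "?z = - 1 \<longleftrightarrow> ?z\<^sup>2 = 1 \<and> ?z \<noteq> 1"
    by (auto simp: power2_eq_1_iff)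
  ultimately show ?thesis using cis_2pi_fraction_eq_1_iff[OF assms, of m] by blast
qed

text \<open>An odd \<open>b\<close> is coprime to 2, so the factor cancels; for even
  \<open>b\<close> the witness is \<open>b / 2\<close>.\<close>

lemma half_multiple_iff_even:
  fixes b :: int
  assumes "b > 0"
  shows "(\<exists>k. b dvd 2 * k \<and> \<not> b dvd k) \<longleftrightarrow> 2 dvd b"
proof
  assume "\<exists>k. b dvd 2 * k \<and> \<not> b dvd k"
  then obtain k where k: "b dvd 2 * k" "\<not> b dvd k" by blast
  show "2 dvd b"
  proof (rule ccontr)
    assume "\<not> 2 dvd b"
    then have "coprime b 2" by (simp add: coprime_commute)
    then show False using k by (simp add: coprime_dvd_mult_right_iff)
  qed
next
  assume "2 dvd b"
  then obtain k where k: "b = 2 * k" by blast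
  then have "\<not> b dvd k" using assms by (intro zdvd_not_zless) auto
  with k show "\<exists>k. b dvd 2 * k \<and> \<not> b dvd k" by (intro exI[of _ k]) simp
qed

text \<open>The parity criterion is applied twice, first to \<open>b\<close> and then to its
  half.\<close>

lemma quarter_multiple_iff_4_dvd:
  fixes b :: int
  assumes "b > 0"
  shows "(\<exists>k. b dvd 4 * k \<and> \<not> b dvd 2 * k) \<longleftrightarrow> 4 dvd b"
proof
  assume "\<exists>k. b dvd 4 * k \<and> \<not> b dvd 2 * k"
  then obtain k where k: "b dvd 2 * (2 * k)" "\<not> b dvd 2 * k" by auto
  then obtain c where c: "b = 2 * c" using half_multiple_iff_even[OF assms] by blast
  with k have "c dvd 2 * k" "\<not> c dvd k" by auto
  then have "2 dvd c" using half_multiple_iff_even[of c] c assms by auto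
  with c show "4 dvd b" by auto
next
  assume "4 dvd b"
  then obtain k where k: "b = 4 * k" by blast
  then have "\<not> b dvd 2 * k" using assms by (intro zdvd_not_zless) auto
  with k show "\<exists>k. b dvd 4 * k \<and> \<not> b dvd 2 * k" by (intro exI[of _ k]) simp
qed

text \<open>The quotient has 2-adic valuation \<nu>(b) - min (\<nu>(b)) (\<nu>(q)). If \<nu>(b)
  \<le> \<nu>(q) this is 0, and \<open>n > 0\<close> makes both sides false.\<close>

lemma two_power_dvd_div_gcd_iff:
  fixes b q :: int
  assumes "b > 0" "q > 0" "n > 0"
  shows "2 ^ n dvd b div gcd b q \<longleftrightarrow> multiplicity 2 q + n \<le> multiplicity 2 b"
proof -
  let ?g = "gcd b q" and ?c = "b div gcd b q"
  have b: "b = ?c * ?g" by simp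
  have nz: "?g \<noteq> 0" "?c \<noteq> 0" using assms(1) b by (auto, metis b mult_zero_left less_irrefl)
  have "multiplicity 2 b = multiplicity 2 ?c + multiplicity 2 ?g"
    using prime_elem_multiplicity_mult_distrib[of 2 ?c ?g] nz b by simp
  moreover have "multiplicity 2 ?g = min (multiplicity 2 b) (multiplicity 2 q)"
    using assms by (intro multiplicity_gcd) auto
  moreover have "2 ^ n dvd ?c \<longleftrightarrow> n \<le> multiplicity 2 ?c"
    using nz by (intro power_dvd_iff_le_multiplicity) auto
  ultimately show ?thesis using assms(3) by auto
qed

lemma dvd_mult_iff_div_gcd_dvd:
  fixes b q k :: int
  assumes "b > 0"
  shows "b dvd q * k \<longleftrightarrow> b div gcd b q dvd k"
proof -
  let ?g = "gcd b q"
  have g: "?g \<noteq> 0" using assms by auto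
  have "b dvd q * k \<longleftrightarrow> (b div ?g) * ?g dvd (q div ?g * k) * ?g"
    by (simp add: mult_ac)
  also have "\<dots> \<longleftrightarrow> b div ?g dvd q div ?g * k" using g by (simp only: dvd_mult_cancel_right simp_thms)
  also have "\<dots> \<longleftrightarrow> b div ?g dvd k"
    using g div_gcd_coprime[of b q] by (simp add: coprime_dvd_mult_right_iff)
  finally show ?thesis .
qed

section \<open>From phase conditions to conditions on the index of \<tau>\<close>

theorem theorem4p4:
  fixes w :: "'n::finite \<Rightarrow> 'n \<Rightarrow> real" and M :: "real^'n^'n" and u v :: 'n
    and \<theta> :: real and lam :: "nat \<Rightarrow> real" and r :: nat and q :: int and \<tau> :: "int \<Rightarrow> real"
  assumes graph: "connected_weighted_graph w"
    and twins: "twins w u v"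
    and M_\<theta>: "(M, \<theta>) \<in> {(adjacency_matrix w, w u u - w u v),
                        (laplacian w, deg w u - w u u + w u v),
                        (signless_laplacian w, deg w u + w u u - w u v)}"
    and cospectral: "strongly_cospectral M u v"
    and periodic: "periodic_vertex M u" "periodic_vertex M v"
    and enum: "bij_betw lam {1..r} (sigma_plus M u v)" and "r \<ge> 2" and "lam 1 > lam 2"
    and q: "q = int (lcm_denom lam r)"
    and \<tau>: "\<And>k. \<tau> k = 2 * pi * of_int q * of_int k / (lam 1 - lam 2)"
  shows "(lam 1 - \<theta>) / (lam 1 - lam 2) \<in> \<rat> \<and>
    (\<forall>a b :: int. b > 0 \<and> coprime a b \<and>
        (lam 1 - \<theta>) / (lam 1 - lam 2) = of_int a / of_int b \<longrightarrow>
      ((\<exists>t. proper_fractional_revival M u v t) \<longleftrightarrow> \<not> b dvd q) \<and>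
      (\<not> b dvd q \<longrightarrow>
        {t. proper_fractional_revival M u v t} = {\<tau> k | k. \<not> (b div gcd b q) dvd k} \<and>
        (multiplicity 2 q \<ge> multiplicity 2 b \<longrightarrow>
          \<not> (\<exists>t. perfect_state_transfer M u v t) \<and>
          \<not> (\<exists>t. balanced_fractional_revival M u v t)) \<and>
        (multiplicity 2 b \<ge> multiplicity 2 q + 1 \<longrightarrow>
          (let T = of_int b * \<tau> 1 / (2 * of_int (gcd b q)) in
             T > 0 \<and> perfect_state_transfer M u v T \<and>
             (\<forall>t>0. perfect_state_transfer M u v t \<longrightarrow> T \<le> t)) \<and>
          ((\<exists>t. balanced_fractional_revival M u v t) \<longleftrightarrow>
            multiplicity 2 b \<ge> multiplicity 2 q + 2))))"
proof -
  interpret strongly_cospectral_twins M \<theta> u v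
    using twins_eigenvector[OF graph twins M_\<theta>] cospectral twins
    by unfold_locales (auto simp: twins_def)
  define c where "c = lam 1 - lam 2"
  have \<tau>_c: "\<tau> k = 2 * pi * of_int q * of_int k / c" for k by (simp only: \<tau> c_def)
  have c: "c > 0" using \<open>lam 1 > lam 2\<close> by (simp add: c_def)
  have sigma: "sigma_plus M u v = lam ` {1..r}" using enum by (simp add: bij_betw_def)
  have l1: "lam 1 \<in> sigma_plus M u v" using \<open>r \<ge> 2\<close> by (simp add: sigma)
  have phase: "cis (t * x) = 1 \<longleftrightarrow> t * x / (2 * pi) \<in> \<int>" for t x
    using cis_2pi_mult_eq_1_iff[of "t * x / (2 * pi)"] by simp

  \<comment> \<open>A single period at which all phases of the support agree supplies every
    rationality statement, including the one for \<theta>.\<close>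
  obtain t0 where t0: "t0 > 0" "in_phase (lam 1) t0" "cis (t0 * (lam 1 - \<theta>)) = 1"
    using periodic(1) periodic_imp_in_phase[OF _ l1] by (auto simp: periodic_vertex_def)
  have ratio: "(lam 1 - x) / c \<in> \<rat>" if "cis (t0 * (lam 1 - x)) = 1" for x
  proof -
    have "cis (t0 * c) = 1"
      using t0(2) \<open>r \<ge> 2\<close> by (simp add: in_phase_def sigma c_def)
    then have "t0 * c / (2 * pi) \<in> \<rat>" "t0 * (lam 1 - x) / (2 * pi) \<in> \<rat>"
      using that phase Ints_subset_Rats by blast+
    then have "(t0 * (lam 1 - x) / (2 * pi)) / (t0 * c / (2 * pi)) \<in> \<rat>" by (rule Rats_divide[rotated])
    then show ?thesis using t0(1) c by simp
  qed
  have rat: "(lam 1 - lam j) / (lam 1 - lam 2) \<in> \<rat>" if "j \<in> {2..r}" for j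
    using ratio[of "lam j"] that t0(2) by (simp add: in_phase_def sigma c_def)
  have qpos: "q > 0" using lcm_denom_pos[of r lam] rat q by simp

  \<comment> \<open>With \<open>s = t * c / (2 * pi)\<close> the phase conditions say that
    \<open>s\<close> clears all the ratios, so \<open>s\<close> runs through the multiples of
    \<open>q\<close>.\<close>
  have in_phase_\<tau>: "in_phase (lam 1) t \<longleftrightarrow> (\<exists>k. t = \<tau> k)" for t
  proof -
    have "{1..r} = insert 1 {2..r}" using \<open>r \<ge> 2\<close> by auto
    then have "in_phase (lam 1) t \<longleftrightarrow> (\<forall>j\<in>{2..r}. t * (lam 1 - lam j) / (2 * pi) \<in> \<int>)"
      by (simp add: in_phase_def sigma phase[symmetric])
    also have "\<dots> \<longleftrightarrow> (\<forall>j\<in>{2..r}. (t * c / (2 * pi)) * ((lam 1 - lam j) / (lam 1 - lam 2)) \<in> \<int>)"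
      using c by (simp add: c_def)
    also have "\<dots> \<longleftrightarrow> (\<exists>k::int. t * c / (2 * pi) = of_int (q * k))"
      unfolding q using rat \<open>r \<ge> 2\<close> \<open>lam 1 > lam 2\<close> by (intro lcm_denom_dvd_iff) auto
    also have "\<dots> \<longleftrightarrow> (\<exists>k. t = \<tau> k)"
      using c by (simp add: \<tau>_c field_simps)
    finally show ?thesis .
  qed

  have main: "((\<exists>t. proper_fractional_revival M u v t) \<longleftrightarrow> \<not> b dvd q) \<and>
      (\<not> b dvd q \<longrightarrow>
        {t. proper_fractional_revival M u v t} = {\<tau> k | k. \<not> (b div gcd b q) dvd k} \<and>
        (multiplicity 2 q \<ge> multiplicity 2 b \<longrightarrow>
          \<not> (\<exists>t. perfect_state_transfer M u v t) \<and>
          \<not> (\<exists>t. balanced_fractional_revival M u v t)) \<and>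
        (multiplicity 2 b \<ge> multiplicity 2 q + 1 \<longrightarrow>
          (let T = of_int b * \<tau> 1 / (2 * of_int (gcd b q)) in
             T > 0 \<and> perfect_state_transfer M u v T \<and>
             (\<forall>t>0. perfect_state_transfer M u v t \<longrightarrow> T \<le> t)) \<and>
          ((\<exists>t. balanced_fractional_revival M u v t) \<longleftrightarrow>
            multiplicity 2 b \<ge> multiplicity 2 q + 2)))"
    if b: "b > 0" and ab: "coprime a b" and frac: "(lam 1 - \<theta>) / (lam 1 - lam 2) = of_int a / of_int b"
    for a b :: int
  proof -
    define d where "d = b div gcd b q"
    have bd: "b = d * gcd b q" by (simp add: d_def)
    have gpos: "gcd b q > 0" using b by simp
    have d: "d > 0" using b gpos by (simp add: d_def pos_imp_zdiv_pos_iff zdvd_imp_le)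
    have angle: "\<tau> k * (lam 1 - \<theta>) = 2 * pi * (of_int (q * k * a) / of_int b)" for k
    proof -
      have "\<tau> k * (lam 1 - \<theta>) = 2 * pi * of_int q * of_int k * ((lam 1 - \<theta>) / (lam 1 - lam 2))"
        by (simp add: \<tau>)
      then show ?thesis unfolding frac by simp
    qed
    \<comment> \<open>The factor \<open>a\<close> cancels by coprimality, and \<open>q\<close>
      reduces the modulus from \<open>b\<close> to \<open>d\<close>. The values 1, 2 and 4 of
      \<open>n\<close> serve the three phenomena.\<close>
    have dvd: "b dvd n * (q * k * a) \<longleftrightarrow> d dvd n * k" for n k
    proof -
      have "b dvd (n * (q * k)) * a \<longleftrightarrow> b dvd n * (q * k)"
        using ab by (simp add: coprime_dvd_mult_left_iff coprime_commute)
      also have "\<dots> \<longleftrightarrow> b dvd q * (n * k)" by (simp add: mult_ac)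
      also have "\<dots> \<longleftrightarrow> d dvd n * k" unfolding d_def by (rule dvd_mult_iff_div_gcd_dvd[OF b])
      finally show ?thesis by (simp add: mult_ac)
    qed
    have proper: "proper_fractional_revival M u v t \<longleftrightarrow> (\<exists>k. t = \<tau> k \<and> \<not> d dvd k)" for t
    proof -
      have "cis (\<tau> k * (lam 1 - \<theta>)) = 1 \<longleftrightarrow> d dvd k" for k
        using dvd[of 1 k] unfolding angle cis_2pi_fraction_eq_1_iff[OF b] by simp
      then show ?thesis unfolding proper_fractional_revival_iff[OF l1] in_phase_\<tau> by auto
    qed
    have pst: "perfect_state_transfer M u v t \<longleftrightarrow> (\<exists>k. t = \<tau> k \<and> d dvd 2 * k \<and> \<not> d dvd k)" for t
    proof -
      have "cis (\<tau> k * (lam 1 - \<theta>)) = - 1 \<longleftrightarrow> d dvd 2 * k \<and> \<not> d dvd k" for k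
        using dvd[of 1 k] dvd[of 2 k] unfolding angle cis_2pi_fraction_eq_minus_1_iff[OF b] by simp
      then show ?thesis unfolding perfect_state_transfer_iff[OF l1] in_phase_\<tau> by auto
    qed
    have balanced: "balanced_fractional_revival M u v t \<longleftrightarrow>
        (\<exists>k. t = \<tau> k \<and> d dvd 4 * k \<and> \<not> d dvd 2 * k)" for t
    proof -
      \<comment> \<open>Balanced revival is the transfer criterion at the doubled angle, so
        \<open>2 * k\<close> replaces \<open>k\<close>.\<close>
      have "cis (2 * (\<tau> k * (lam 1 - \<theta>))) = - 1 \<longleftrightarrow> d dvd 4 * k \<and> \<not> d dvd 2 * k" for k
      proof -
        have "2 * (\<tau> k * (lam 1 - \<theta>)) = 2 * pi * (of_int (2 * (q * k * a)) / of_int b)"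
          unfolding angle by simp
        moreover have "b dvd 2 * (2 * (q * k * a)) \<longleftrightarrow> d dvd 4 * k"
          using dvd[of 4 k] by (simp add: mult.assoc)
        ultimately show ?thesis
          by (simp only: cis_2pi_fraction_eq_minus_1_iff[OF b] dvd[of 2])
      qed
      then show ?thesis unfolding balanced_fractional_revival_iff[OF l1] in_phase_\<tau> by auto
    qed
    have d1: "d dvd k * 1 \<longleftrightarrow> b dvd q * k" for k
      unfolding d_def using dvd_mult_iff_div_gcd_dvd[OF b] by simp
    have ex_proper: "(\<exists>t. proper_fractional_revival M u v t) \<longleftrightarrow> \<not> b dvd q"
    proof -
      \<comment> \<open>Some index escapes \<open>d\<close> exactly when \<open>d\<close> does not
        divide 1, which by \<open>d1\<close> means that \<open>b\<close> does not divide
        \<open>q\<close>.\<close>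
      have "(\<exists>k. \<not> d dvd k) \<longleftrightarrow> \<not> d dvd 1" by (meson dvd_trans one_dvd)
      then show ?thesis unfolding proper using d1[of 1] by auto
    qed
    have set_proper: "{t. proper_fractional_revival M u v t} = {\<tau> k | k. \<not> (b div gcd b q) dvd k}"
      unfolding proper d_def by auto
    have ex_pst: "(\<exists>t. perfect_state_transfer M u v t) \<longleftrightarrow> multiplicity 2 b \<ge> multiplicity 2 q + 1"
      using half_multiple_iff_even[OF d] two_power_dvd_div_gcd_iff[OF b qpos, of 1]
      unfolding pst d_def by auto
    have ex_bal: "(\<exists>t. balanced_fractional_revival M u v t) \<longleftrightarrow> multiplicity 2 b \<ge> multiplicity 2 q + 2"
      using quarter_multiple_iff_4_dvd[OF d] two_power_dvd_div_gcd_iff[OF b qpos, of 2]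
      unfolding balanced d_def by auto
    have min_pst: "let T = of_int b * \<tau> 1 / (2 * of_int (gcd b q)) in
        T > 0 \<and> perfect_state_transfer M u v T \<and> (\<forall>t>0. perfect_state_transfer M u v t \<longrightarrow> T \<le> t)"
      if "multiplicity 2 b \<ge> multiplicity 2 q + 1"
    proof -
      have "2 dvd d" using that two_power_dvd_div_gcd_iff[OF b qpos, of 1] by (simp add: d_def)
      then obtain h where h: "d = 2 * h" by blast
      have hpos: "h > 0" using h d by simp
      have "real_of_int b = 2 * of_int h * of_int (gcd b q)"
        by (subst bd) (simp add: h)
      then have T: "of_int b * \<tau> 1 / (2 * of_int (gcd b q)) = \<tau> h"
        using gpos by (simp add: \<tau>_c)
      have "\<tau> h > 0" using hpos qpos c by (simp add: \<tau>_c)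
      moreover have "\<not> d dvd h" using hpos h by (intro zdvd_not_zless) auto
      then have "perfect_state_transfer M u v (\<tau> h)" unfolding pst using h by auto
      moreover have "\<tau> h \<le> t" if "t > 0" "perfect_state_transfer M u v t" for t
      proof -
        obtain k where k: "t = \<tau> k" "d dvd 2 * k" using \<open>perfect_state_transfer M u v t\<close> pst by blast
        have "0 < 2 * pi * of_int q / c * real_of_int k" using \<open>t > 0\<close> by (simp add: k \<tau>_c)
        moreover have "0 < 2 * pi * of_int q / c" using qpos c by simp
        ultimately have "0 < real_of_int k" by (rule zero_less_mult_pos)
        then have "k > 0" by simp
        \<comment> \<open>Cancelling 2 in \<open>2 * h dvd 2 * k\<close> leaves
          \<open>h dvd k\<close> with \<open>k\<close> positive.\<close>
        then have "h \<le> k" using k(2) h by (simp add: zdvd_imp_le)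
        then show ?thesis
          using qpos c by (simp add: k \<tau>_c divide_right_mono mult_left_mono)
      qed
      ultimately show ?thesis unfolding Let_def T by blast
    qed
    show ?thesis using ex_proper set_proper ex_pst ex_bal min_pst by auto
  qed
  have "(lam 1 - \<theta>) / (lam 1 - lam 2) \<in> \<rat>" using ratio[OF t0(3)] by (simp add: c_def)
  with main show ?thesis by blast
qed

end
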